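(* For every graph $G$, $$\max_{\sigma}\mathrm{fix}(G_\sigma)=\max_{H\in\mathcal{H}'(G)}\mathrm{mis}(H),$$ where the first maximum is over all repartitions of signs $\sigma$ in $G$.
   Context: A graph means a finite loop-less symmetric digraph, i.e. each undirected edge $\{u,v\}$ of a finite simple graph is viewed as the two arcs $uv$ and $vu$. $\mathrm{mis}(G)$ is the number of (inclusion-)maximal independent sets of $G$. A repartition of signs $\sigma$ in $G$ assigns to each arc a sign, positive or negative (zero signs are not allowed); the arcs $uv$ and $vu$ may get different signs. $G_\sigma$ is $G$ together with $\sigma$. With $V$ the vertex set of $G$, the conjunctive network on $G_\sigma$ is the map $f:\{0,1\}^V\to\{0,1\}^V$ with $$f_v(x)=\prod_{u:\ uv\text{ is a positive arc}}x_u\ \prod_{u:\ uv\text{ is a negative arc}}(1-x_u)\qquad(v\in V),$$ an empty product being 1. $\mathrm{fix}(G_\sigma)$ is the number of $x\in\{0,1\}^V$ with $f(x)=x$. For a connected subgraph $C$ of $G$ with at least two vertices, $G/C$ is the graph obtained from $G$ by contracting $C$ into a single new vertex $c$ (so $c$ is adjacent to every vertex outside $C$ that has a neighbor in $C$; loops and multiple edges are discarded) and by adding a new vertex $c'$ together with the edge $cc'$. $\mathcal{H}'(G)$ is the set of graphs that can be obtained from $G$ by repeating such an operation (any number of times, including zero, so $G\in\mathcal{H}'(G)$). *)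

theory Defs
  imports
    "HOL-Library.FuncSet"
    "Graph_Theory.Pair_Digraph"
    "Graph_Theory.Digraph_Component"
begin

(* A graph is a "pair_graph": a finite loop-free symmetric digraph without parallel arcs, the
   arc uv being the pair (u, v). *)

definition independent :: "'a pair_pre_digraph \<Rightarrow> 'a set \<Rightarrow> bool" where
  "independent G S \<longleftrightarrow> S \<subseteq> pverts G \<and> (\<forall>u\<in>S. \<forall>v\<in>S. (u, v) \<notin> parcs G)"

definition maximal_independent :: "'a pair_pre_digraph \<Rightarrow> 'a set \<Rightarrow> bool" where
  "maximal_independent G S \<longleftrightarrow>
     independent G S \<and> (\<forall>T. independent G T \<and> S \<subseteq> T \<longrightarrow> T = S)"

definition mis :: "'a pair_pre_digraph \<Rightarrow> nat" where
  "mis G = card {S. maximal_independent G S}"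

datatype sign = Positive | Negative

(* A repartition of signs is a total function on pairs; its values outside the arc set of G
   are never used. *)
type_synonym 'a signing = "'a \<times> 'a \<Rightarrow> sign"

definition configurations :: "'a pair_pre_digraph \<Rightarrow> ('a \<Rightarrow> int) set" where
  "configurations G = pverts G \<rightarrow>\<^sub>E {0, 1}"

definition conjunctive_network ::
    "'a pair_pre_digraph \<Rightarrow> 'a signing \<Rightarrow> ('a \<Rightarrow> int) \<Rightarrow> ('a \<Rightarrow> int)" where
  "conjunctive_network G \<sigma> x = (\<lambda>v\<in>pverts G.
     (\<Prod>u\<in>{u. (u, v) \<in> parcs G \<and> \<sigma> (u, v) = Positive}. x u) *
     (\<Prod>u\<in>{u. (u, v) \<in> parcs G \<and> \<sigma> (u, v) = Negative}. 1 - x u))"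

definition num_fixpoints :: "'a pair_pre_digraph \<Rightarrow> 'a signing \<Rightarrow> nat" where
  "num_fixpoints G \<sigma> = card {x \<in> configurations G. conjunctive_network G \<sigma> x = x}"

(* G/C, where S is the vertex set of C and c, c' are the two new vertices. *)
definition contract ::
    "'a pair_pre_digraph \<Rightarrow> 'a set \<Rightarrow> 'a \<Rightarrow> 'a \<Rightarrow> 'a pair_pre_digraph" where
  "contract G S c c' = \<lparr>
     pverts = (pverts G - S) \<union> {c, c'},
     parcs = {(u, v) \<in> parcs G. u \<notin> S \<and> v \<notin> S}
       \<union> {(c, v) | v. v \<in> pverts G - S \<and> (\<exists>u\<in>S. (u, v) \<in> parcs G)}
       \<union> {(v, c) | v. v \<in> pverts G - S \<and> (\<exists>u\<in>S. (v, u) \<in> parcs G)}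
       \<union> {(c, c'), (c', c)} \<rparr>"

(* The graphs obtained by repeated contraction, with every admissible choice of names for the
   new vertices.  These names only have to differ from the vertices that survive, so a name from
   the contracted C may be reused.  Since C has at least two vertices, the names exist even when
   the vertices of G exhaust the type. *)
inductive_set contractions :: "'a pair_pre_digraph \<Rightarrow> 'a pair_pre_digraph set"
  for G :: "'a pair_pre_digraph" where
  refl: "G \<in> contractions G"
| step: "\<lbrakk>H \<in> contractions G;
          pair_graph C; subgraph (with_proj C) (with_proj H); connected (with_proj C);
          card (pverts C) \<ge> 2;
          c \<notin> pverts H - pverts C; c' \<notin> pverts H - pverts C; c \<noteq> c'\<rbrakk>
         \<Longrightarrow> contract H (pverts C) c c' \<in> contractions G"

(* Both sets of which a maximum is taken are finite and nonempty, as Max requires. *)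

lemma pair_graph_contract:
  assumes "pair_graph H" "c \<notin> pverts H - S" "c' \<notin> pverts H - S" "c \<noteq> c'"
  shows "pair_graph (contract H S c c')"
proof -
  interpret H: pair_graph H by fact
  let ?K = "contract H S c c'"
  have sym: "(u, v) \<in> parcs H \<Longrightarrow> (v, u) \<in> parcs H" for u v
    using H.pair_sym_arcs by (auto simp: symmetric_def dest: symD)
  have arc: "(u, v) \<in> parcs ?K \<longleftrightarrow>
      (u, v) \<in> parcs H \<and> u \<notin> S \<and> v \<notin> S
    \<or> u = c \<and> v \<in> pverts H - S \<and> (\<exists>w\<in>S. (w, v) \<in> parcs H)
    \<or> v = c \<and> u \<in> pverts H - S \<and> (\<exists>w\<in>S. (u, w) \<in> parcs H)
    \<or> u = c \<and> v = c' \<or> u = c' \<and> v = c" for u v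
    unfolding contract_def by auto
  have vert: "pverts ?K = pverts H - S \<union> {c, c'}"
    by (simp add: contract_def)
  have sym': "(v, u) \<in> parcs ?K" if "(u, v) \<in> parcs ?K" for u v
    using that sym unfolding arc by meson
  have wf: "u \<in> pverts ?K \<and> v \<in> pverts ?K" if "(u, v) \<in> parcs ?K" for u v
    using that H.in_arcsD1[of u v] H.in_arcsD2[of u v] unfolding arc vert by blast
  have loopfree: "u \<noteq> v" if "(u, v) \<in> parcs ?K" for u v
    using that assms(2-4) H.no_loops'[of u v] unfolding arc by blast
  have fin: "finite (pverts ?K)"
    using H.pair_finite_verts by (simp add: contract_def)
  have "parcs ?K \<subseteq> pverts ?K \<times> pverts ?K"
    using wf by auto
  then have "finite (parcs ?K)"
    using fin finite_subset by blast
  then show ?thesis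
    using wf fin loopfree
    by unfold_locales (auto simp: symmetric_def intro!: symI dest: sym')
qed

lemma pair_graph_contractions:
  assumes "pair_graph G" "H \<in> contractions G"
  shows "pair_graph H"
  using assms(2)
proof induction
  case refl
  show ?case by fact
next
  case (step H C c c')
  then show ?case by (blast intro: pair_graph_contract)
qed

lemma card_contractions_le:
  assumes "pair_graph G" "H \<in> contractions G"
  shows "card (pverts H) \<le> card (pverts G)"
  using assms(2)
proof induction
  case (step H C c c')
  interpret H: pair_graph H using step.hyps(1) assms(1) by (rule pair_graph_contractions[rotated])
  have sub: "pverts C \<subseteq> pverts H"
    using step.hyps by (simp add: subgraph_def)
  have "card (pverts (contract H (pverts C) c c')) \<le> card (pverts H - pverts C) + card {c, c'}"
    by (simp only: contract_def pair_pre_digraph.simps card_Un_le)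
  also have "\<dots> \<le> card (pverts H - pverts C) + card (pverts C)"
    using step.hyps by simp
  also have "\<dots> = card (pverts H)"
    using sub H.pair_finite_verts
    by (metis card_Diff_subset card_mono finite_subset le_add_diff_inverse2)
  finally show ?case using step.IH by simp
qed simp

lemma finite_mis_contractions:
  assumes "pair_graph G"
  shows "finite (mis ` contractions G)" "mis ` contractions G \<noteq> {}"
proof -
  have "mis H \<le> 2 ^ card (pverts G)" if "H \<in> contractions G" for H
  proof -
    interpret H: pair_graph H using assms that by (rule pair_graph_contractions)
    have "{S. maximal_independent H S} \<subseteq> Pow (pverts H)"
      by (auto simp: maximal_independent_def independent_def)
    then have "mis H \<le> 2 ^ card (pverts H)"
      unfolding mis_def by (metis H.pair_finite_verts card_Pow card_mono finite_Pow_iff)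
    also have "\<dots> \<le> 2 ^ card (pverts G)"
      using card_contractions_le[OF assms that] by simp
    finally show ?thesis .
  qed
  then show "finite (mis ` contractions G)"
    by - (rule finite_subset[of _ "{..2 ^ card (pverts G)}"], auto)
  show "mis ` contractions G \<noteq> {}"
    using contractions.refl by blast
qed

lemma finite_num_fixpoints:
  assumes "pair_graph G"
  shows "finite (range (num_fixpoints G))" "range (num_fixpoints G) \<noteq> {}"
proof -
  interpret G: pair_graph G by fact
  have fin: "finite (configurations G)"
    using G.pair_finite_verts by (auto simp: configurations_def intro: finite_PiE)
  have "num_fixpoints G \<sigma> \<le> card (configurations G)" for \<sigma>
    unfolding num_fixpoints_def by (rule card_mono[OF fin]) blast
  then show "finite (range (num_fixpoints G))"
    by - (rule finite_subset[of _ "{..card (configurations G)}"], auto)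
qed simp

end

theory Submission
  imports Defs
begin

text \<open>
  Identify a fixed point with the set of vertices in state 1; when all arcs are negative, these sets
  are the maximal independent sets.

  For \<open>\<ge>\<close>, a signing of \<open>G/C\<close> is pulled back to \<open>G\<close> with all arcs inside \<open>C\<close> positive, which makes
  \<open>C\<close> constant in every fixed point; the state of \<open>c'\<close> is determined by that of \<open>c\<close>, so no fixed
  point is lost.

  For \<open>\<le>\<close>, induct on the number of positive arcs. If a positive arc meets the set \<open>Z\<close> of vertices
  that are 0 in every fixed point, make all arcs at \<open>Z\<close> negative and complete each fixed point
  greedily inside \<open>Z\<close>. Otherwise every positive arc \<open>ab\<close> is positive in both directions, and \<open>a\<close>, \<open>b\<close>
  carry equal signs towards and from each common neighbour, so the signs descend to \<open>G/ab\<close>, with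
  negative signs on \<open>cc'\<close>.
\<close>

section \<open>Fixed points as sets of vertices\<close>

text \<open>\<open>X\<close> is the set of vertices in state 1. The inner equivalence says that the
  arc \<open>(u, v)\<close> contributes the factor 1 to the product at \<open>v\<close>, so positive
  and negative arcs need no separate treatment.\<close>

definition fixed_set :: "'a pair_pre_digraph \<Rightarrow> 'a signing \<Rightarrow> 'a set \<Rightarrow> bool" where
  "fixed_set G \<sigma> X \<longleftrightarrow> X \<subseteq> pverts G \<and>
     (\<forall>v\<in>pverts G. v \<in> X \<longleftrightarrow> (\<forall>u. (u, v) \<in> parcs G \<longrightarrow> (u \<in> X \<longleftrightarrow> \<sigma> (u, v) = Positive)))"

definition positive_arcs :: "'a pair_pre_digraph \<Rightarrow> 'a signing \<Rightarrow> ('a \<times> 'a) set" where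
  "positive_arcs G \<sigma> = {e \<in> parcs G. \<sigma> e = Positive}"

lemma fixed_setI:
  assumes "X \<subseteq> pverts G"
    and "\<And>u v. v \<in> X \<Longrightarrow> (u, v) \<in> parcs G \<Longrightarrow> u \<in> X \<longleftrightarrow> \<sigma> (u, v) = Positive"
    and "\<And>v. v \<in> pverts G \<Longrightarrow> v \<notin> X \<Longrightarrow>
           \<exists>u. (u, v) \<in> parcs G \<and> \<not> (u \<in> X \<longleftrightarrow> \<sigma> (u, v) = Positive)"
  shows "fixed_set G \<sigma> X"
  unfolding fixed_set_def using assms by blast

lemma fixed_set_subset: "fixed_set G \<sigma> X \<Longrightarrow> X \<subseteq> pverts G"
  by (simp add: fixed_set_def)

lemma fixed_set_arc:
  assumes "fixed_set G \<sigma> X" "v \<in> X" "(u, v) \<in> parcs G"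
  shows "u \<in> X \<longleftrightarrow> \<sigma> (u, v) = Positive"
  using assms unfolding fixed_set_def by blast

lemma fixed_set_obstruction:
  assumes "fixed_set G \<sigma> X" "v \<in> pverts G" "v \<notin> X"
  obtains u where "(u, v) \<in> parcs G" "\<not> (u \<in> X \<longleftrightarrow> \<sigma> (u, v) = Positive)"
  using assms unfolding fixed_set_def by blast

lemma prod_of_bool_Ball:
  "finite A \<Longrightarrow> (\<Prod>u\<in>A. of_bool (P u)) = (of_bool (\<forall>u\<in>A. P u) :: 'b :: comm_semiring_1)"
  by (induction A rule: finite_induct) auto

text \<open>A product of factors from {0, 1} is 1 exactly when no factor vanishes; the positive and
  the negative product each become one bounded quantifier.\<close>

lemma conjunctive_network_indicator:
  fixes G :: "'a pair_pre_digraph"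
  assumes "pair_graph G" "v \<in> pverts G"
  shows "conjunctive_network G \<sigma> (\<lambda>w\<in>pverts G. of_bool (w \<in> X)) v =
    of_bool (\<forall>u. (u, v) \<in> parcs G \<longrightarrow> (u \<in> X \<longleftrightarrow> \<sigma> (u, v) = Positive))"
proof -
  interpret G: pair_graph G by fact
  let ?x = "\<lambda>w\<in>pverts G. of_bool (w \<in> X) :: int"
  let ?P = "{u. (u, v) \<in> parcs G \<and> \<sigma> (u, v) = Positive}"
  let ?N = "{u. (u, v) \<in> parcs G \<and> \<sigma> (u, v) = Negative}"
  have sub: "?P \<subseteq> pverts G" "?N \<subseteq> pverts G"
    using G.in_arcsD1 by auto
  then have fin: "finite ?P" "finite ?N"
    using G.pair_finite_verts finite_subset by blast+
  have "(\<Prod>u\<in>?P. ?x u) = (\<Prod>u\<in>?P. of_bool (u \<in> X))"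
    by (rule prod.cong) (use sub in auto)
  moreover have "(\<Prod>u\<in>?N. 1 - ?x u) = (\<Prod>u\<in>?N. of_bool (u \<notin> X))"
    by (rule prod.cong) (use sub in auto)
  ultimately have "conjunctive_network G \<sigma> ?x v =
      of_bool (\<forall>u\<in>?P. u \<in> X) * of_bool (\<forall>u\<in>?N. u \<notin> X)"
    using assms(2) unfolding conjunctive_network_def
    by (simp only: restrict_apply' prod_of_bool_Ball[OF fin(1)] prod_of_bool_Ball[OF fin(2)])
  also have "\<dots> = of_bool ((\<forall>u\<in>?P. u \<in> X) \<and> (\<forall>u\<in>?N. u \<notin> X))"
    by (simp only: of_bool_conj)
  also have "((\<forall>u\<in>?P. u \<in> X) \<and> (\<forall>u\<in>?N. u \<notin> X)) \<longleftrightarrow>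
      (\<forall>u. (u, v) \<in> parcs G \<longrightarrow> (u \<in> X \<longleftrightarrow> \<sigma> (u, v) = Positive))"
  proof -
    have "\<sigma> e = Negative \<longleftrightarrow> \<sigma> e \<noteq> Positive" for e
      by (cases "\<sigma> e") auto
    then show ?thesis by auto
  qed
  finally show ?thesis .
qed

lemma num_fixpoints_eq_card_fixed_sets:
  fixes G :: "'a pair_pre_digraph"
  assumes "pair_graph G"
  shows "num_fixpoints G \<sigma> = card {X. fixed_set G \<sigma> X}"
proof -
  let ?V = "pverts G"
  let ?f = "\<lambda>X. \<lambda>w\<in>?V. of_bool (w \<in> X) :: int"
  let ?g = "\<lambda>x. {v \<in> ?V. x v = (1 :: int)}"
  have fixed: "conjunctive_network G \<sigma> (?f X) = ?f X \<longleftrightarrow> fixed_set G \<sigma> X" if "X \<subseteq> ?V" for X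
  proof -
    have at: "conjunctive_network G \<sigma> (?f X) v = ?f X v \<longleftrightarrow>
        (v \<in> X \<longleftrightarrow> (\<forall>u. (u, v) \<in> parcs G \<longrightarrow> (u \<in> X \<longleftrightarrow> \<sigma> (u, v) = Positive)))"
      if "v \<in> ?V" for v
      unfolding conjunctive_network_indicator[OF assms that] restrict_apply'[OF that] of_bool_eq_iff
      by (rule eq_commute)
    \<comment> \<open>Both sides are \<open>undefined\<close> off the vertex set, so comparing them
      at the vertices suffices.\<close>
    have "conjunctive_network G \<sigma> (?f X) = ?f X \<longleftrightarrow>
        (\<forall>v\<in>?V. conjunctive_network G \<sigma> (?f X) v = ?f X v)"
      by (auto simp: conjunctive_network_def fun_eq_iff)
    also have "\<dots> \<longleftrightarrow> fixed_set G \<sigma> X"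
      by (simp only: at fixed_set_def that simp_thms cong: ball_cong)
    finally show ?thesis .
  qed
  have fg: "?f (?g x) = x" if "x \<in> configurations G" for x
  proof
    fix v
    show "?f (?g x) v = x v"
    proof (cases "v \<in> ?V")
      case True
      then have "x v \<in> {0, 1}"
        using that unfolding configurations_def by (metis PiE_mem)
      with True show ?thesis by (elim insertE) simp_all
    next
      case False
      have "x v = undefined"
        using that False unfolding configurations_def by (rule PiE_arb)
      with False show ?thesis by simp
    qed
  qed
  have "bij_betw ?f {X. fixed_set G \<sigma> X} {x \<in> configurations G. conjunctive_network G \<sigma> x = x}"
  proof (rule bij_betwI[where g = ?g])
    show "?f \<in> {X. fixed_set G \<sigma> X} \<rightarrow> {x \<in> configurations G. conjunctive_network G \<sigma> x = x}"
    proof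
      fix X assume "X \<in> {X. fixed_set G \<sigma> X}"
      then have X: "fixed_set G \<sigma> X" by simp
      moreover have "?f X \<in> configurations G" by (auto simp: configurations_def)
      ultimately show "?f X \<in> {x \<in> configurations G. conjunctive_network G \<sigma> x = x}"
        using fixed[OF fixed_set_subset[OF X]] by simp
    qed
    show "?g \<in> {x \<in> configurations G. conjunctive_network G \<sigma> x = x} \<rightarrow> {X. fixed_set G \<sigma> X}"
    proof
      fix x assume x: "x \<in> {x \<in> configurations G. conjunctive_network G \<sigma> x = x}"
      have "?g x \<subseteq> ?V" by blast
      from fixed[OF this] show "?g x \<in> {X. fixed_set G \<sigma> X}"
        using x fg[of x] by simp
    qed
    show "?g (?f X) = X" if "X \<in> {X. fixed_set G \<sigma> X}" for X
      using that fixed_set_subset[of G \<sigma> X] by auto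
    show "?f (?g x) = x" if "x \<in> {x \<in> configurations G. conjunctive_network G \<sigma> x = x}" for x
      using that fg by simp
  qed
  from bij_betw_same_card[OF this] show ?thesis
    unfolding num_fixpoints_def by simp
qed

text \<open>Common frame for the three comparisons of counts below: pulling back along a
  contraction, isolating \<open>Z\<close>, and contracting a positive edge.\<close>

lemma num_fixpoints_le:
  fixes G H :: "'a pair_pre_digraph"
  assumes "pair_graph G" "pair_graph H"
    and "\<And>X. fixed_set G \<sigma> X \<Longrightarrow> fixed_set H \<tau> (F X)"
    and "inj_on F {X. fixed_set G \<sigma> X}"
  shows "num_fixpoints G \<sigma> \<le> num_fixpoints H \<tau>"
proof -
  interpret H: pair_graph H by fact
  have "finite {X. fixed_set H \<tau> X}"
    by (rule finite_subset[of _ "Pow (pverts H)"]) (auto simp: H.pair_finite_verts dest: fixed_set_subset)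
  moreover have "F ` {X. fixed_set G \<sigma> X} \<subseteq> {X. fixed_set H \<tau> X}"
    using assms(3) by blast
  ultimately show ?thesis
    using assms by (simp add: num_fixpoints_eq_card_fixed_sets card_inj_on_le)
qed

section \<open>All-negative signings and maximal independent sets\<close>

lemma pair_graph_sym:
  assumes "pair_graph G" "(u, v) \<in> parcs G"
  shows "(v, u) \<in> parcs G"
proof -
  interpret G: pair_graph G by fact
  show ?thesis using G.pair_sym_arcs assms(2) by (auto simp: symmetric_def dest: symD)
qed

lemma pair_graph_irrefl:
  assumes "pair_graph G"
  shows "(v, v) \<notin> parcs G"
proof -
  interpret G: pair_graph G by fact
  show ?thesis using G.pair_no_loops[of "(v, v)"] by auto
qed

lemma pair_graph_wf:
  assumes "pair_graph G" "(u, v) \<in> parcs G"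
  shows "u \<in> pverts G" "v \<in> pverts G"
proof -
  interpret G: pair_graph G by fact
  show "u \<in> pverts G" "v \<in> pverts G"
    using G.in_arcsD1[OF assms(2)] G.in_arcsD2[OF assms(2)] .
qed

text \<open>Brings maximality into the vertexwise shape of \<open>fixed_set\<close>. A vertex
  without neighbour in \<open>S\<close> could be added to \<open>S\<close>, by symmetry and the
  absence of loops.\<close>

lemma maximal_independent_iff:
  assumes "pair_graph G"
  shows "maximal_independent G S \<longleftrightarrow>
    S \<subseteq> pverts G \<and> (\<forall>v\<in>pverts G. v \<in> S \<longleftrightarrow> (\<forall>u. (u, v) \<in> parcs G \<longrightarrow> u \<notin> S))" (is "_ \<longleftrightarrow> ?R")
proof
  assume max: "maximal_independent G S"
  then have ind: "S \<subseteq> pverts G" "\<forall>u\<in>S. \<forall>v\<in>S. (u, v) \<notin> parcs G"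
    by (auto simp: maximal_independent_def independent_def)
  moreover have "v \<in> S" if "v \<in> pverts G" "\<forall>u. (u, v) \<in> parcs G \<longrightarrow> u \<notin> S" for v
  proof -
    have "independent G (insert v S)"
      using ind that pair_graph_sym[OF assms] pair_graph_irrefl[OF assms]
      unfolding independent_def by blast
    then show ?thesis using max unfolding maximal_independent_def by blast
  qed
  ultimately show ?R by blast
next
  assume ?R
  then show "maximal_independent G S"
    unfolding maximal_independent_def independent_def
    using pair_graph_sym[OF assms] by blast
qed

lemma num_fixpoints_eq_mis:
  assumes "pair_graph G" "positive_arcs G \<sigma> = {}"
  shows "num_fixpoints G \<sigma> = mis G"
proof -
  have "\<sigma> (u, v) \<noteq> Positive" if "(u, v) \<in> parcs G" for u v
    using assms(2) that by (auto simp: positive_arcs_def)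
  then have "fixed_set G \<sigma> X \<longleftrightarrow> maximal_independent G X" for X
    unfolding maximal_independent_iff[OF assms(1)] fixed_set_def by blast
  then show ?thesis
    using assms(1) by (simp add: num_fixpoints_eq_card_fixed_sets mis_def)
qed

section \<open>Lower bound: pulling signings back along contractions\<close>

lemma contract_simps:
  shows "pverts (contract G S c c') = (pverts G - S) \<union> {c, c'}"
    and "(u, v) \<in> parcs (contract G S c c') \<longleftrightarrow>
      (u, v) \<in> parcs G \<and> u \<notin> S \<and> v \<notin> S
    \<or> u = c \<and> v \<in> pverts G - S \<and> (\<exists>w\<in>S. (w, v) \<in> parcs G)
    \<or> v = c \<and> u \<in> pverts G - S \<and> (\<exists>w\<in>S. (u, w) \<in> parcs G)
    \<or> u = c \<and> v = c' \<or> u = c' \<and> v = c"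
  unfolding contract_def by auto

text \<open>\<open>nbr\<close> is what connectedness of the contracted subgraph supplies: a vertex
  of \<open>S\<close> in state 0 is held there by a positive arc from another vertex of
  \<open>S\<close>, also in state 0.\<close>

lemma num_fixpoints_contract_le:
  fixes G :: "'a pair_pre_digraph"
  assumes G: "pair_graph G"
    and c: "c \<notin> pverts G - S" "c' \<notin> pverts G - S" "c \<noteq> c'"
    and S: "S \<subseteq> pverts G" "S \<noteq> {}"
    and nbr: "\<And>v. v \<in> S \<Longrightarrow> \<exists>u\<in>S. (u, v) \<in> parcs G"
  shows "\<exists>\<tau>. num_fixpoints (contract G S c c') \<sigma> \<le> num_fixpoints G \<tau>"
proof -
  let ?K = "contract G S c c'"
  \<comment> \<open>\<open>r\<close> is the quotient map onto the contraction; it sends no vertex of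
    \<open>G\<close> to \<open>c'\<close>. Signs and fixed sets are pulled back along it.\<close>
  define r where "r v = (if v \<in> S then c else v)" for v
  define \<tau> where "\<tau> = (\<lambda>(u, v). if u \<in> S \<and> v \<in> S then Positive else \<sigma> (r u, r v))"
  define F where "F X = {v \<in> pverts G. r v \<in> X}" for X
  have arcK: "(r u, r v) \<in> parcs ?K" if "(u, v) \<in> parcs G" "\<not> (u \<in> S \<and> v \<in> S)" for u v
    using that pair_graph_wf[OF G that(1)] unfolding contract_simps r_def by auto
  have K: "pair_graph ?K"
    using G c by (rule pair_graph_contract)
  have "fixed_set G \<tau> (F X)" if X: "fixed_set ?K \<sigma> X" for X
  proof (rule fixed_setI)
    show "F X \<subseteq> pverts G" by (auto simp: F_def)
  next
    fix u v assume v: "v \<in> F X" and uv: "(u, v) \<in> parcs G"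
    have u: "u \<in> pverts G" using pair_graph_wf[OF G uv] by simp
    show "u \<in> F X \<longleftrightarrow> \<tau> (u, v) = Positive"
    proof (cases "u \<in> S \<and> v \<in> S")
      case True
      then show ?thesis using u v by (simp add: F_def \<tau>_def r_def)
    next
      case False
      have "r u \<in> X \<longleftrightarrow> \<sigma> (r u, r v) = Positive"
        using fixed_set_arc[OF X _ arcK[OF uv False]] v by (simp add: F_def)
      with False u show ?thesis by (auto simp: F_def \<tau>_def)
    qed
  next
    fix v assume v: "v \<in> pverts G" "v \<notin> F X"
    show "\<exists>u. (u, v) \<in> parcs G \<and> \<not> (u \<in> F X \<longleftrightarrow> \<tau> (u, v) = Positive)"
    proof (cases "v \<in> S")
      case True
      \<comment> \<open>The reason why \<open>c\<close> is 0 in the contraction may be the pendant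
        \<open>c'\<close>, which has no counterpart in \<open>G\<close>; a neighbour inside
        \<open>S\<close> takes over.\<close>
      then obtain u where "u \<in> S" "(u, v) \<in> parcs G" using nbr by blast
      with True v show ?thesis by (auto simp: F_def \<tau>_def r_def)
    next
      case False
      then have "v \<in> pverts ?K" "v \<notin> X" "v \<noteq> c" "v \<noteq> c'"
        using v c by (auto simp: contract_simps F_def r_def)
      then obtain w where w: "(w, v) \<in> parcs ?K" "\<not> (w \<in> X \<longleftrightarrow> \<sigma> (w, v) = Positive)"
        using fixed_set_obstruction[OF X] by blast
      \<comment> \<open>An arc into a vertex other than \<open>c\<close> and \<open>c'\<close> lifts
        to \<open>G\<close>; if it starts at \<open>c\<close>, its lift starts in
        \<open>S\<close>.\<close>
      from w(1) \<open>v \<noteq> c\<close> \<open>v \<noteq> c'\<close> obtain u where u: "(u, v) \<in> parcs G" "r u = w"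
        unfolding contract_simps r_def by auto
      with w False pair_graph_wf[OF G u(1)] show ?thesis
        by (intro exI[of _ u]) (auto simp: F_def \<tau>_def r_def)
    qed
  qed
  moreover have "inj_on F {X. fixed_set ?K \<sigma> X}"
  proof (rule inj_onI)
    fix X Y assume "X \<in> {X. fixed_set ?K \<sigma> X}" "Y \<in> {X. fixed_set ?K \<sigma> X}" and eq: "F X = F Y"
    then have X: "fixed_set ?K \<sigma> X" and Y: "fixed_set ?K \<sigma> Y" by auto
    have out: "v \<in> X \<longleftrightarrow> v \<in> Y" if "v \<in> pverts G - S" for v
      using eq that by (auto simp: F_def r_def set_eq_iff split: if_splits)
    have cc: "c \<in> X \<longleftrightarrow> c \<in> Y"
    proof -
      obtain s where s: "s \<in> S" "s \<in> pverts G" using S by blast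
      then have "s \<in> F Z \<longleftrightarrow> c \<in> Z" for Z by (simp add: F_def r_def)
      with eq show ?thesis by metis
    qed
    \<comment> \<open>\<open>F\<close> forgets \<open>c'\<close>, but the only neighbour of
      \<open>c'\<close> is \<open>c\<close>, so its state can be recovered.\<close>
    have pend: "c' \<in> Z \<longleftrightarrow> (c \<in> Z \<longleftrightarrow> \<sigma> (c, c') = Positive)" if "fixed_set ?K \<sigma> Z" for Z
    proof -
      have "(u, c') \<in> parcs ?K \<longleftrightarrow> u = c" for u
        using c pair_graph_wf[OF G] unfolding contract_simps by blast
      moreover have "c' \<in> pverts ?K" by (simp add: contract_simps)
      ultimately show ?thesis using that by (simp add: fixed_set_def)
    qed
    show "X = Y"
    proof (rule set_eqI)
      fix v
      consider "v \<in> pverts G - S" | "v = c" | "v = c'" | "v \<notin> pverts ?K"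
        by (auto simp: contract_simps)
      then show "v \<in> X \<longleftrightarrow> v \<in> Y"
        using out cc pend[OF X] pend[OF Y] fixed_set_subset[OF X] fixed_set_subset[OF Y]
        by cases auto
    qed
  qed
  ultimately show ?thesis
    using num_fixpoints_le[OF K G] by blast
qed

text \<open>A walk from \<open>v\<close> to a second vertex must leave \<open>v\<close> along an
  arc.\<close>

lemma connected_pair_graph_neighbour:
  assumes "pair_graph C" "connected (with_proj C)" "card (pverts C) \<ge> 2" "v \<in> pverts C"
  shows "\<exists>u\<in>pverts C. (u, v) \<in> parcs C"
proof -
  interpret C: pair_graph C by fact
  have "\<exists>w\<in>pverts C. w \<noteq> v"
  proof (rule ccontr)
    assume "\<not> ?thesis"
    then have "pverts C \<subseteq> {v}" by blast
    then have "card (pverts C) \<le> 1" using card_mono[of "{v}"] by fastforce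
    then show False using assms(3) by simp
  qed
  then obtain w where w: "w \<in> pverts C" "w \<noteq> v" by blast
  \<comment> \<open>\<open>connected\<close> refers to the symmetric closure; for a symmetric
    digraph this gives directed reachability.\<close>
  have "strongly_connected (with_proj C)"
    using C.symmetric_connected_imp_strongly_connected C.pair_sym_arcs assms(2) by simp
  then have "v \<rightarrow>\<^sup>*\<^bsub>with_proj C\<^esub> w"
    using w assms(4) by (auto simp: strongly_connected_def)
  then obtain u where "(v, u) \<in> parcs C"
    using w(2) by (cases rule: C.converse_reachable_cases) auto
  then show ?thesis
    using pair_graph_sym[OF assms(1)] pair_graph_wf[OF assms(1)] by blast
qed

text \<open>The induction generalises the signing, since undoing one contraction yields a new
  signing of the previous graph.\<close>

lemma num_fixpoints_contractions_le:
  assumes "pair_graph G" "H \<in> contractions G"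
  shows "\<exists>\<tau>. num_fixpoints H \<sigma> \<le> num_fixpoints G \<tau>"
  using assms(2)
proof (induction arbitrary: \<sigma>)
  case refl
  show ?case by blast
next
  case (step H C c c')
  have "pair_graph H" using pair_graph_contractions[OF assms(1) step.hyps(1)] .
  moreover have "pverts C \<subseteq> pverts H" and CH: "parcs C \<subseteq> parcs H"
    using step.hyps by (auto simp: subgraph_def)
  moreover have "pverts C \<noteq> {}" using step.hyps by auto
  moreover have "\<exists>u\<in>pverts C. (u, v) \<in> parcs H" if "v \<in> pverts C" for v
    using connected_pair_graph_neighbour[OF _ _ _ that] step.hyps CH by blast
  ultimately obtain \<rho> where
    "num_fixpoints (contract H (pverts C) c c') \<sigma> \<le> num_fixpoints H \<rho>"
    using num_fixpoints_contract_le step.hyps by metis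
  with step.IH[of \<rho>] show ?case by (meson order_trans)
qed

section \<open>Composing contractions and contracting one edge\<close>

text \<open>The upper bound performs a first contraction and then recurses, whereas the inductive
  definition appends a last one.\<close>

lemma contractions_trans:
  assumes "H \<in> contractions G" "K \<in> contractions H"
  shows "K \<in> contractions G"
  using assms(2,1) by induction (auto intro: contractions.step)

text \<open>The new vertices reuse the names of the contracted edge, so the vertex set does not change; \<open>b\<close>
  becomes the pendant vertex.\<close>
lemma contract_edge_in_contractions:
  assumes "pair_graph G" "(a, b) \<in> parcs G"
  shows "contract G {a, b} a b \<in> contractions G"
proof -
  let ?C = "\<lparr>pverts = {a, b}, parcs = {(a, b), (b, a)}\<rparr>"
  interpret G: pair_graph G by fact
  have ab: "a \<noteq> b" "a \<in> pverts G" "b \<in> pverts G" "(b, a) \<in> parcs G"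
    using assms(2) pair_graph_irrefl[OF assms(1)] pair_graph_wf[OF assms] pair_graph_sym[OF assms] by auto
  interpret C: pair_graph ?C
    using ab(1) by unfold_locales (auto simp: symmetric_def sym_def)
  have "subgraph (with_proj ?C) (with_proj G)"
    using ab assms(2) C.wf_digraph_axioms G.wf_digraph_axioms
    by (auto simp: subgraph_def compatible_def)
  moreover have "connected (with_proj ?C)"
  proof -
    have "mk_symmetric (with_proj ?C) = ?C"
      by (auto simp: mk_symmetric_def)
    moreover have "a \<rightarrow>\<^sup>*\<^bsub>with_proj ?C\<^esub> b" "b \<rightarrow>\<^sup>*\<^bsub>with_proj ?C\<^esub> a"
      "a \<rightarrow>\<^sup>*\<^bsub>with_proj ?C\<^esub> a" "b \<rightarrow>\<^sup>*\<^bsub>with_proj ?C\<^esub> b"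
      by (auto intro: C.reachable_adjI C.reachable_refl)
    ultimately show ?thesis
      unfolding connected_def strongly_connected_def by simp
  qed
  ultimately have "contract G (pverts ?C) a b \<in> contractions G"
    using ab(1) by (intro contractions.step contractions.refl C.pair_graph_axioms) auto
  then show ?thesis by simp
qed

section \<open>Upper bound: eliminating positive arcs\<close>

text \<open>Outside \<open>Z\<close> a fixed set \<open>X\<close> stays valid, because vertices of
  \<open>Z\<close> never hold an outside vertex at 0. Inside \<open>Z\<close> it is completed to a
  set \<open>Y\<close> with \<open>Y - Z = X\<close>, which makes the assignment injective.\<close>

lemma num_fixpoints_le_isolate_signs:
  fixes G :: "'a pair_pre_digraph"
  assumes G: "pair_graph G"
    and Z: "Z = {v \<in> pverts G. \<forall>X. fixed_set G \<sigma> X \<longrightarrow> v \<notin> X}"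
    and \<tau>: "\<tau> = (\<lambda>(u, v). if u \<in> Z \<or> v \<in> Z then Negative else \<sigma> (u, v))"
  shows "num_fixpoints G \<sigma> \<le> num_fixpoints G \<tau>"
proof -
  interpret G: pair_graph G by fact
  \<comment> \<open>A positive arc from a vertex that is always 0 forces its head to be always
    0.\<close>
  have arc_into_Z: "v \<in> Z" if "(u, v) \<in> parcs G" "u \<in> Z" "\<sigma> (u, v) = Positive" for u v
  proof -
    have "v \<notin> X" if "fixed_set G \<sigma> X" for X
      using fixed_set_arc[OF that _ \<open>(u, v) \<in> parcs G\<close>] that \<open>u \<in> Z\<close> \<open>\<sigma> (u, v) = Positive\<close>
      by (auto simp: Z)
    with pair_graph_wf[OF G that(1)] show ?thesis by (simp add: Z)
  qed
  have "\<exists>Y. fixed_set G \<tau> Y \<and> Y - Z = X" if X: "fixed_set G \<sigma> X" for X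
  proof -
    have XZ: "X \<inter> Z = {}" using X unfolding Z by blast
    \<comment> \<open>Candidate extensions of \<open>X\<close> into \<open>Z\<close>: added vertices
      have no neighbour in the extension, so the new negative arcs obstruct no vertex of it. A
      maximal candidate is the greedy completion.\<close>
    define A where "A = {Y. X \<subseteq> Y \<and> Y \<subseteq> X \<union> Z \<and> (\<forall>u\<in>Y \<inter> Z. \<forall>v\<in>Y. (u, v) \<notin> parcs G)}"
    have "A \<subseteq> Pow (pverts G)"
      using fixed_set_subset[OF X] unfolding A_def Z by blast
    then have "finite A" using G.pair_finite_verts by (simp add: finite_subset)
    moreover have "X \<in> A" using XZ unfolding A_def by blast
    ultimately obtain Y where Y: "Y \<in> A" and max: "\<forall>T\<in>A. Y \<subseteq> T \<longrightarrow> Y = T"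
      using finite_has_maximal[of A] by blast
    have YX: "v \<in> Y \<longleftrightarrow> v \<in> X" if "v \<notin> Z" for v
      using Y that unfolding A_def by blast
    have nonadj: "(u, v) \<notin> parcs G" if "u \<in> Y" "v \<in> Y" "u \<in> Z \<or> v \<in> Z" for u v
      using Y that pair_graph_sym[OF G] unfolding A_def by blast
    have "fixed_set G \<tau> Y"
    proof (rule fixed_setI)
      show "Y \<subseteq> pverts G" using Y \<open>A \<subseteq> _\<close> by blast
    next
      fix u v assume v: "v \<in> Y" and uv: "(u, v) \<in> parcs G"
      show "u \<in> Y \<longleftrightarrow> \<tau> (u, v) = Positive"
      proof (cases "u \<in> Z \<or> v \<in> Z")
        case True
        then show ?thesis using nonadj v uv unfolding \<tau> by auto
      next
        case False
        then show ?thesis using fixed_set_arc[OF X _ uv] YX v unfolding \<tau> by auto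
      qed
    next
      fix v assume v: "v \<in> pverts G" "v \<notin> Y"
      show "\<exists>u. (u, v) \<in> parcs G \<and> \<not> (u \<in> Y \<longleftrightarrow> \<tau> (u, v) = Positive)"
      proof (cases "v \<in> Z")
        case True
        \<comment> \<open>Maximality: \<open>v\<close> cannot be added, so it has a neighbour in
          \<open>Y\<close>, and the arc from there is negative.\<close>
        have "insert v Y \<notin> A" using max v by blast
        then obtain u where "u \<in> Y" "(u, v) \<in> parcs G"
          using Y True pair_graph_sym[OF G] pair_graph_irrefl[OF G] unfolding A_def by blast
        with True show ?thesis unfolding \<tau> by auto
      next
        case False
        then have "v \<notin> X" using v YX by blast
        then obtain u where u: "(u, v) \<in> parcs G" "\<not> (u \<in> X \<longleftrightarrow> \<sigma> (u, v) = Positive)"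
          using fixed_set_obstruction[OF X v(1)] by blast
        \<comment> \<open>Were \<open>u\<close> in \<open>Z\<close>, it would be 0 and the
          obstructing arc positive, putting \<open>v\<close> into \<open>Z\<close>.\<close>
        have "u \<notin> Z" using u arc_into_Z False XZ by blast
        with u False YX show ?thesis unfolding \<tau> by auto
      qed
    qed
    moreover have "Y - Z = X" using YX XZ by blast
    ultimately show ?thesis by blast
  qed
  then obtain F where F: "\<And>X. fixed_set G \<sigma> X \<Longrightarrow> fixed_set G \<tau> (F X) \<and> F X - Z = X"
    by metis
  then have "inj_on F {X. fixed_set G \<sigma> X}"
    by (intro inj_onI) (metis mem_Collect_eq)
  with F show ?thesis by (intro num_fixpoints_le[OF G G]) auto
qed

text \<open>By \<open>alive\<close>, each end of a positive arc is 1 in some fixed set, and there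
  the states of its in-neighbours reveal the signs of the arcs entering it. This forces enough
  agreement between \<open>a\<close> and \<open>b\<close> to merge them.\<close>

lemma num_fixpoints_le_contract_edge:
  fixes G :: "'a pair_pre_digraph"
  assumes G: "pair_graph G"
    and alive: "\<And>u v. (u, v) \<in> positive_arcs G \<sigma> \<Longrightarrow>
      (\<exists>X. fixed_set G \<sigma> X \<and> u \<in> X) \<and> (\<exists>X. fixed_set G \<sigma> X \<and> v \<in> X)"
    and pos: "(a, b) \<in> positive_arcs G \<sigma>"
  shows "\<exists>\<tau>. num_fixpoints G \<sigma> \<le> num_fixpoints (contract G {a, b} a b) \<tau> \<and>
    card (positive_arcs (contract G {a, b} a b) \<tau>) < card (positive_arcs G \<sigma>)"
proof -
  interpret G: pair_graph G by fact
  let ?K = "contract G {a, b} a b"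
  have ab: "(a, b) \<in> parcs G" "\<sigma> (a, b) = Positive"
    using pos by (auto simp: positive_arcs_def)
  have ne: "a \<noteq> b" and ba: "(b, a) \<in> parcs G" and V: "a \<in> pverts G" "b \<in> pverts G"
    using ab(1) pair_graph_irrefl[OF G] pair_graph_sym[OF G ab(1)] pair_graph_wf[OF G ab(1)] by auto
  have K: "pair_graph ?K"
    using pair_graph_contractions[OF G contract_edge_in_contractions[OF G ab(1)]] .
  have "\<sigma> (b, a) = Positive"
    using alive[OF pos] fixed_set_arc ab ba by metis
  then have same: "a \<in> X \<longleftrightarrow> b \<in> X" if "fixed_set G \<sigma> X" for X
    using fixed_set_arc[OF that] ab ba by metis
  \<comment> \<open>If one of the two arcs is positive, \<open>w\<close> is 1 in some fixed set;
    \<open>a\<close> and \<open>b\<close> share their state there, so both arcs are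
    positive.\<close>
  have out: "\<sigma> (a, w) = \<sigma> (b, w)" if "(a, w) \<in> parcs G" "(b, w) \<in> parcs G" for w
  proof -
    have "\<sigma> (a, w) = Positive \<longleftrightarrow> \<sigma> (b, w) = Positive"
      using that alive[of a w] alive[of b w] same fixed_set_arc unfolding positive_arcs_def
      by (metis (mono_tags, lifting) mem_Collect_eq)
    then show ?thesis by (metis sign.exhaust)
  qed
  \<comment> \<open>Both signs are read off from the state of \<open>w\<close> in a fixed set
    containing \<open>a\<close> and \<open>b\<close>.\<close>
  have into: "\<sigma> (w, a) = \<sigma> (w, b)" if "(w, a) \<in> parcs G" "(w, b) \<in> parcs G" for w
  proof -
    obtain X where "fixed_set G \<sigma> X" "a \<in> X" "b \<in> X"
      using alive[OF pos] same by blast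
    then have "\<sigma> (w, a) = Positive \<longleftrightarrow> \<sigma> (w, b) = Positive"
      using that fixed_set_arc by metis
    then show ?thesis by (metis sign.exhaust)
  qed
  \<comment> \<open>\<open>q\<close> merges \<open>b\<close> into \<open>a\<close>, while the name
    \<open>b\<close> passes to the pendant vertex. Where both \<open>a\<close> and \<open>b\<close>
    have an arc, \<open>out\<close> and \<open>into\<close> make the choice in \<open>\<tau>\<close>
    immaterial.\<close>
  define q where "q u = (if u = b then a else u)" for u
  define \<tau> where "\<tau> = (\<lambda>(u, v).
    if u = b \<or> v = b then Negative
    else if u = a then (if (a, v) \<in> parcs G then \<sigma> (a, v) else \<sigma> (b, v))
    else if v = a then (if (u, a) \<in> parcs G then \<sigma> (u, a) else \<sigma> (u, b))
    else \<sigma> (u, v))"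
  have arcK: "(u, v) \<in> parcs ?K \<longleftrightarrow> u = a \<and> v = b \<or> u = b \<and> v = a \<or>
    u \<noteq> b \<and> v \<noteq> b \<and> (u \<noteq> a \<or> v \<noteq> a) \<and> (\<exists>u' v'. (u', v') \<in> parcs G \<and> q u' = u \<and> q v' = v)"
    for u v
    using ne G.in_arcsD1 G.in_arcsD2 pair_graph_irrefl[OF G]
    unfolding contract_simps q_def by auto
  have sign: "\<tau> (q u, q v) = \<sigma> (u, v)" if "(u, v) \<in> parcs G" "q u \<noteq> a \<or> q v \<noteq> a" for u v
    using that ne out into unfolding \<tau>_def q_def by (auto split: if_splits)
  \<comment> \<open>The pendant \<open>b\<close> takes the state opposite to \<open>a\<close>. If
    \<open>a\<close> is 0, the pendant is 1 and its negative arc keeps \<open>a\<close> at 0,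
    replacing the obstructions lost by merging.\<close>
  define F where "F X = (if a \<in> X then X - {b} else insert b X)" for X
  have qF: "q u \<in> F X \<longleftrightarrow> u \<in> X" if "fixed_set G \<sigma> X" for u X
    using same[OF that] ne unfolding q_def F_def by auto
  have "fixed_set ?K \<tau> (F X)" if X: "fixed_set G \<sigma> X" for X
  proof (rule fixed_setI)
    show "F X \<subseteq> pverts ?K"
      using fixed_set_subset[OF X] V unfolding contract_simps F_def by auto
  next
    fix u v assume v: "v \<in> F X" and uv: "(u, v) \<in> parcs ?K"
    from uv[unfolded arcK] consider "u = a \<and> v = b \<or> u = b \<and> v = a"
      | u' v' where "u \<noteq> b" "v \<noteq> b" "u \<noteq> a \<or> v \<noteq> a" "(u', v') \<in> parcs G" "q u' = u" "q v' = v"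
      by blast
    then show "u \<in> F X \<longleftrightarrow> \<tau> (u, v) = Positive"
    proof cases
      case 1
      then show ?thesis using v ne unfolding F_def \<tau>_def by (auto split: if_splits)
    next
      case 2
      then show ?thesis using qF[OF X] sign fixed_set_arc[OF X] v by metis
    qed
  next
    fix v assume v: "v \<in> pverts ?K" "v \<notin> F X"
    show "\<exists>u. (u, v) \<in> parcs ?K \<and> \<not> (u \<in> F X \<longleftrightarrow> \<tau> (u, v) = Positive)"
    proof (cases "v = a \<or> v = b")
      case True
      then show ?thesis
        using v ne unfolding F_def \<tau>_def arcK by (auto split: if_splits)
    next
      case False
      then have qv: "q v = v" "v \<in> pverts G"
        using v unfolding contract_simps by (auto simp: q_def)
      then have "v \<notin> X" using qF[OF X, of v] v by simp
      then obtain u where u: "(u, v) \<in> parcs G" "\<not> (u \<in> X \<longleftrightarrow> \<sigma> (u, v) = Positive)"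
        using fixed_set_obstruction[OF X qv(2)] by blast
      moreover have "(q u, v) \<in> parcs ?K"
        using u(1) qv(1) False ne unfolding arcK by (auto simp: q_def)
      moreover have "\<tau> (q u, v) = \<sigma> (u, v)"
        using sign[OF u(1)] qv(1) False by simp
      ultimately show ?thesis using qF[OF X] by metis
    qed
  qed
  moreover have "inj_on F {X. fixed_set G \<sigma> X}"
    by (rule inj_onI) (use qF in \<open>metis mem_Collect_eq subsetI subset_antisym\<close>)
  ultimately have le: "num_fixpoints G \<sigma> \<le> num_fixpoints ?K \<tau>"
    by (rule num_fixpoints_le[OF G K])
  have fin: "finite (positive_arcs G \<sigma>)"
    using G.pair_finite_arcs by (simp add: positive_arcs_def)
  \<comment> \<open>Pendant arcs are negative, and \<open>(a, b)\<close> collapses to a loop under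
    \<open>q\<close>, so at least one positive arc disappears.\<close>
  have "positive_arcs ?K \<tau> \<subseteq> map_prod q q ` (positive_arcs G \<sigma> - {(a, b)})"
  proof (rule subrelI)
    fix u v assume "(u, v) \<in> positive_arcs ?K \<tau>"
    then have uv: "(u, v) \<in> parcs ?K" "\<tau> (u, v) = Positive" by (auto simp: positive_arcs_def)
    then have "u \<noteq> b" "v \<noteq> b" by (auto simp: \<tau>_def)
    with uv(1) obtain u' v' where *: "u \<noteq> a \<or> v \<noteq> a" "(u', v') \<in> parcs G" "q u' = u" "q v' = v"
      unfolding arcK by blast
    then have "(u', v') \<in> positive_arcs G \<sigma> - {(a, b)}"
      using sign[of u' v'] uv(2) by (auto simp: positive_arcs_def q_def)
    with * show "(u, v) \<in> map_prod q q ` (positive_arcs G \<sigma> - {(a, b)})" by force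
  qed
  then have "card (positive_arcs ?K \<tau>) \<le> card (positive_arcs G \<sigma> - {(a, b)})"
    using fin by (meson card_image_le card_mono finite_Diff finite_imageI order_trans)
  also have "\<dots> < card (positive_arcs G \<sigma>)"
    using fin pos by (meson card_Diff1_less)
  finally show ?thesis using le by blast
qed

text \<open>The measure is taken over all signed graphs: isolating \<open>Z\<close> keeps the graph,
  contracting an edge replaces it, and either step loses a positive arc.\<close>

lemma num_fixpoints_le_mis_contraction:
  fixes G :: "'a pair_pre_digraph"
  assumes "pair_graph G"
  shows "\<exists>H\<in>contractions G. num_fixpoints G \<sigma> \<le> mis H"
  using assms
proof (induction "card (positive_arcs G \<sigma>)" arbitrary: G \<sigma> rule: less_induct)
  case less
  note G = \<open>pair_graph G\<close>
  interpret G: pair_graph G by fact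
  define Z where "Z = {v \<in> pverts G. \<forall>X. fixed_set G \<sigma> X \<longrightarrow> v \<notin> X}"
  consider (none) "positive_arcs G \<sigma> = {}"
    | (dead) u v where "(u, v) \<in> positive_arcs G \<sigma>" "u \<in> Z \<or> v \<in> Z"
    | (alive) a b where "(a, b) \<in> positive_arcs G \<sigma>"
        "\<And>u v. (u, v) \<in> positive_arcs G \<sigma> \<Longrightarrow> u \<notin> Z \<and> v \<notin> Z"
    by (metis equals0I surj_pair)
  then show ?case
  proof cases
    case none
    then show ?thesis
      using num_fixpoints_eq_mis[OF G none] contractions.refl by force
  next
    case dead
    define \<tau> where "\<tau> = (\<lambda>(u, v). if u \<in> Z \<or> v \<in> Z then Negative else \<sigma> (u, v))"
    have "positive_arcs G \<tau> \<subseteq> positive_arcs G \<sigma> - {(u, v)}"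
      using dead(2) by (auto simp: positive_arcs_def \<tau>_def split: if_splits)
    then have "positive_arcs G \<tau> \<subset> positive_arcs G \<sigma>"
      using dead(1) by blast
    moreover have "finite (positive_arcs G \<sigma>)"
      using G.pair_finite_arcs by (simp add: positive_arcs_def)
    ultimately have "card (positive_arcs G \<tau>) < card (positive_arcs G \<sigma>)"
      by (simp add: psubset_card_mono)
    then obtain H where "H \<in> contractions G" "num_fixpoints G \<tau> \<le> mis H"
      using less.hyps G by blast
    with num_fixpoints_le_isolate_signs[OF G Z_def \<tau>_def] show ?thesis by force
  next
    case alive
    have "(\<exists>X. fixed_set G \<sigma> X \<and> u \<in> X) \<and> (\<exists>X. fixed_set G \<sigma> X \<and> v \<in> X)"
      if "(u, v) \<in> positive_arcs G \<sigma>" for u v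
      using alive(2)[OF that] that pair_graph_wf[OF G, of u v]
      unfolding Z_def positive_arcs_def by blast
    from num_fixpoints_le_contract_edge[OF G this alive(1)]
    obtain \<tau> where \<tau>: "num_fixpoints G \<sigma> \<le> num_fixpoints (contract G {a, b} a b) \<tau>"
      "card (positive_arcs (contract G {a, b} a b) \<tau>) < card (positive_arcs G \<sigma>)"
      by blast
    have K: "contract G {a, b} a b \<in> contractions G"
      using contract_edge_in_contractions[OF G] alive(1) by (simp add: positive_arcs_def)
    obtain H where "H \<in> contractions (contract G {a, b} a b)"
      "num_fixpoints (contract G {a, b} a b) \<tau> \<le> mis H"
      using less.hyps[OF \<tau>(2) pair_graph_contractions[OF G K]] by blast
    with contractions_trans[OF K] \<tau>(1) show ?thesis by (meson order_trans)
  qed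
qed

section \<open>Equality of the two maxima\<close>

theorem theorem3:
  fixes G :: "'a pair_pre_digraph"
  assumes "pair_graph G"
  shows "Max {num_fixpoints G \<sigma> | \<sigma>. True} = Max {mis H | H. H \<in> contractions G}"
proof (rule antisym)
  have eq: "{num_fixpoints G \<sigma> | \<sigma>. True} = range (num_fixpoints G)"
    "{mis H | H. H \<in> contractions G} = mis ` contractions G"
    by auto
  note fin = finite_num_fixpoints[OF assms] finite_mis_contractions[OF assms]
  show "Max {num_fixpoints G \<sigma> | \<sigma>. True} \<le> Max {mis H | H. H \<in> contractions G}"
    unfolding eq
  proof (rule Max.boundedI[OF fin(1,2)])
    fix n assume "n \<in> range (num_fixpoints G)"
    then obtain H where "H \<in> contractions G" "n \<le> mis H"
      using num_fixpoints_le_mis_contraction[OF assms] by blast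
    then show "n \<le> Max (mis ` contractions G)"
      using fin(3) by (meson Max_ge imageI order_trans)
  qed
  \<comment> \<open>The all-negative signing realises \<open>mis H\<close> on \<open>H\<close> and
    is then pulled back to \<open>G\<close>.\<close>
  have le: "\<exists>\<sigma>. mis H \<le> num_fixpoints G \<sigma>" if "H \<in> contractions G" for H
  proof -
    have "num_fixpoints H (\<lambda>_. Negative) = mis H"
      using pair_graph_contractions[OF assms that]
      by (rule num_fixpoints_eq_mis) (simp add: positive_arcs_def)
    then show ?thesis
      using num_fixpoints_contractions_le[OF assms that, of "\<lambda>_. Negative"] by simp
  qed
  show "Max {mis H | H. H \<in> contractions G} \<le> Max {num_fixpoints G \<sigma> | \<sigma>. True}"
    unfolding eq
  proof (rule Max.boundedI[OF fin(3,4)])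
    fix n assume "n \<in> mis ` contractions G"
    then obtain \<sigma> where "n \<le> num_fixpoints G \<sigma>"
      using le by blast
    then show "n \<le> Max (range (num_fixpoints G))"
      using fin(1) by (meson Max_ge rangeI order_trans)
  qed
qed

end
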